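(* Let $\mathbb{F}_k$ be the free group on $k\ge 2$ generators ($k$ finite). Let $S$ be any finite symmetric generating set of $\mathbb{F}_k$ and let $d_S$ be the metric of the Cayley graph of $\mathbb{F}_k$ with respect to $S$. Then there are no finite orbits in $\partial(\mathbb{F}_k,d_S)$; that is, for every $h\in\partial(\mathbb{F}_k,d_S)$ the orbit $\mathbb{F}_k.h$ is infinite.
   Context: Cayley metric: for a finite symmetric generating set $S=S^{-1}$ of a group $G$, the Cayley graph has vertex set $G$ and edges $x\sim y\iff x^{-1}y\in S$; $d_S$ is its graph metric (the word metric), which is left-invariant. Metric-functional boundary: for a metric $d$ on a group $G$ with base point $1$, let $L(G,d)$ be the set of functions $h:G\to\mathbb{R}$ with $h(1)=0$ and $|h(x)-h(y)|\le d(x,y)$ for all $x,y\in G$, with the topology of pointwise convergence. For $x\in G$ let $b_x(y)=d(x,y)-d(x,1)$, so $b_x\in L(G,d)$. Let $\overline{(G,d)}$ be the closure of $\{b_x : x\in G\}$ in $L(G,d)$, and $\partial(G,d)=\overline{(G,d)}\setminus\{b_x : x\in G\}$. For left-invariant $d$, the group $G$ acts on $L(G,d)$ by $(x.h)(y)=h(x^{-1}y)-h(x^{-1})$, and this action preserves $\partial(G,d)$. The orbit of $h$ is $G.h=\{x.h : x\in G\}$. *)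

theory Defs
  imports "HOL-Algebra.Group_Action" "HOL-Algebra.Generated_Groups" "HOL-Analysis.Function_Topology"
begin

section \<open>Free groups\<close>

text \<open>
  The letter \<open>(a, True)\<close> stands for the generator \<open>a\<close> and \<open>(a, False)\<close> for its formal inverse.
  The free group on \<open>X\<close> consists of the reduced words over these letters; the product is
  concatenation followed by free reduction, performed by prepending the letters of the left
  factor one by one.
\<close>

type_synonym 'a letter = "'a \<times> bool"

fun inv_letter :: "'a letter \<Rightarrow> 'a letter" where
  "inv_letter (a, e) = (a, \<not> e)"

definition reduced :: "'a letter list \<Rightarrow> bool" where
  "reduced = successively (\<lambda>a b. b \<noteq> inv_letter a)"

fun cons_reduce :: "'a letter \<Rightarrow> 'a letter list \<Rightarrow> 'a letter list" where
  "cons_reduce a [] = [a]"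
| "cons_reduce a (b # w) = (if b = inv_letter a then w else a # b # w)"

definition free_group :: "'a set \<Rightarrow> 'a letter list monoid" where
  "free_group X =
     \<lparr>carrier = {w. reduced w \<and> set w \<subseteq> X \<times> UNIV},
      mult = (\<lambda>u v. foldr cons_reduce u v),
      one = []\<rparr>"

lemma inv_letter_inv_letter [simp]: "inv_letter (inv_letter a) = a"
  by (cases a) simp

lemma inv_letter_neq [simp]: "inv_letter a \<noteq> a" "a \<noteq> inv_letter a"
  by (cases a; simp)+

lemma fst_inv_letter [simp]: "fst (inv_letter a) = fst a"
  by (cases a) simp

lemma reduced_Nil [simp]: "reduced []"
  by (simp add: reduced_def)

lemma reduced_Cons: "reduced (a # w) \<longleftrightarrow> w = [] \<or> hd w \<noteq> inv_letter a \<and> reduced w"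
  by (auto simp: reduced_def successively_Cons)

lemma reduced_cons_reduce: "reduced w \<Longrightarrow> reduced (cons_reduce a w)"
  by (cases w) (auto simp: reduced_Cons)

lemma set_cons_reduce: "set (cons_reduce a w) \<subseteq> insert a (set w)"
  by (cases w) auto

lemma reduced_foldr: "reduced v \<Longrightarrow> reduced (foldr cons_reduce u v)"
  by (induction u) (auto intro: reduced_cons_reduce)

lemma set_foldr: "set (foldr cons_reduce u v) \<subseteq> set u \<union> set v"
proof (induction u)
  case (Cons a u)
  then show ?case using set_cons_reduce[of a "foldr cons_reduce u v"] by auto
qed simp

lemma cons_reduce_inverse: "reduced w \<Longrightarrow> cons_reduce (inv_letter a) (cons_reduce a w) = w"
  by (cases w; cases "tl w") (auto simp: reduced_Cons)

lemma cons_reduce_inverse': "reduced w \<Longrightarrow> cons_reduce a (cons_reduce (inv_letter a) w) = w"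
  using cons_reduce_inverse[of w "inv_letter a"] by simp

lemma foldr_cons_reduce:
  assumes "reduced w"
  shows "foldr cons_reduce (cons_reduce a u) w = cons_reduce a (foldr cons_reduce u w)"
  by (cases u) (auto simp: cons_reduce_inverse' reduced_foldr assms)

lemma foldr_assoc:
  assumes "reduced w"
  shows "foldr cons_reduce (foldr cons_reduce u v) w = foldr cons_reduce u (foldr cons_reduce v w)"
  by (induction u) (simp_all add: foldr_cons_reduce assms)

lemma foldr_Nil: "reduced u \<Longrightarrow> foldr cons_reduce u [] = u"
proof (induction u)
  case (Cons a u)
  then show ?case by (cases u) (auto simp: reduced_Cons)
qed simp

lemma foldr_inverse:
  "reduced w \<Longrightarrow> foldr cons_reduce (map inv_letter (rev u)) (foldr cons_reduce u w) = w"
  by (induction u) (simp_all add: cons_reduce_inverse reduced_foldr)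

lemma reduced_inverse:
  assumes "reduced u" shows "reduced (map inv_letter (rev u))"
  using assms
  by (auto simp: reduced_def successively_map successively_rev elim!: successively_mono)

lemma group_free_group: "group (free_group X)"
proof (rule groupI)
  fix u assume u: "u \<in> carrier (free_group X)"
  have "map inv_letter (rev u) \<in> carrier (free_group X)"
    using u by (force simp: free_group_def reduced_inverse)
  moreover have "map inv_letter (rev u) \<otimes>\<^bsub>free_group X\<^esub> u = \<one>\<^bsub>free_group X\<^esub>"
    using u foldr_inverse[of "[]" u] by (simp add: free_group_def foldr_Nil)
  ultimately show "\<exists>v\<in>carrier (free_group X). v \<otimes>\<^bsub>free_group X\<^esub> u = \<one>\<^bsub>free_group X\<^esub>"
    by blast
next
  fix u v assume "u \<in> carrier (free_group X)" "v \<in> carrier (free_group X)"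
  then show "u \<otimes>\<^bsub>free_group X\<^esub> v \<in> carrier (free_group X)"
    using set_foldr[of u v] by (auto simp: free_group_def reduced_foldr)
qed (auto simp: free_group_def foldr_assoc)


section \<open>Cayley graphs and their metric\<close>

definition cayley_edges :: "('a, 'b) monoid_scheme \<Rightarrow> 'a set \<Rightarrow> ('a \<times> 'a) set" where
  "cayley_edges G S =
     {(x, y). x \<in> carrier G \<and> y \<in> carrier G \<and> inv\<^bsub>G\<^esub> x \<otimes>\<^bsub>G\<^esub> y \<in> S}"

text \<open>Length of a shortest path; only meaningful if the graph connects the two vertices, which is
  the case when \<open>S\<close> is a symmetric generating set.\<close>

definition cayley_metric :: "('a, 'b) monoid_scheme \<Rightarrow> 'a set \<Rightarrow> 'a \<Rightarrow> 'a \<Rightarrow> real" where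
  "cayley_metric G S x y = real (LEAST n. (x, y) \<in> cayley_edges G S ^^ n)"


section \<open>The metric-functional boundary\<close>

text \<open>Functions on \<open>carrier G\<close> are represented as extensional functions, that is, they are
  \<^term>\<open>undefined\<close> off the carrier, so that equality of functions is equality on the carrier.\<close>

definition lip_functions :: "('a, 'b) monoid_scheme \<Rightarrow> ('a \<Rightarrow> 'a \<Rightarrow> real) \<Rightarrow> ('a \<Rightarrow> real) set" where
  "lip_functions G d =
     {h \<in> extensional (carrier G).
        h \<one>\<^bsub>G\<^esub> = 0 \<and> (\<forall>x\<in>carrier G. \<forall>y\<in>carrier G. \<bar>h x - h y\<bar> \<le> d x y)}"

text \<open>The topology of pointwise convergence.\<close>

definition lip_topology ::
    "('a, 'b) monoid_scheme \<Rightarrow> ('a \<Rightarrow> 'a \<Rightarrow> real) \<Rightarrow> ('a \<Rightarrow> real) topology" where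
  "lip_topology G d =
     subtopology (product_topology (\<lambda>_. euclideanreal) (carrier G)) (lip_functions G d)"

definition point_functional ::
    "('a, 'b) monoid_scheme \<Rightarrow> ('a \<Rightarrow> 'a \<Rightarrow> real) \<Rightarrow> 'a \<Rightarrow> 'a \<Rightarrow> real" where
  "point_functional G d x = (\<lambda>y\<in>carrier G. d x y - d x \<one>\<^bsub>G\<^esub>)"

definition metric_compactification ::
    "('a, 'b) monoid_scheme \<Rightarrow> ('a \<Rightarrow> 'a \<Rightarrow> real) \<Rightarrow> ('a \<Rightarrow> real) set" where
  "metric_compactification G d = lip_topology G d closure_of (point_functional G d ` carrier G)"

definition metric_boundary ::
    "('a, 'b) monoid_scheme \<Rightarrow> ('a \<Rightarrow> 'a \<Rightarrow> real) \<Rightarrow> ('a \<Rightarrow> real) set" where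
  "metric_boundary G d = metric_compactification G d - point_functional G d ` carrier G"

definition boundary_action ::
    "('a, 'b) monoid_scheme \<Rightarrow> 'a \<Rightarrow> ('a \<Rightarrow> real) \<Rightarrow> 'a \<Rightarrow> real" where
  "boundary_action G x h = (\<lambda>y\<in>carrier G. h (inv\<^bsub>G\<^esub> x \<otimes>\<^bsub>G\<^esub> y) - h (inv\<^bsub>G\<^esub> x))"

end

theory Submission
  imports Defs
begin

text \<open>
  Let \<open>K\<close> bound the lengths of the elements of \<open>S\<close>. A path of the Cayley graph that changes the
  first letter of a word passes through a word of length at most \<open>K\<close>, so
  \<open>d p g \<ge> d p 1 + d 1 g - C\<close> whenever the word \<open>g\<close> begins with a letter that \<open>p\<close> does not
  begin with.

  If the orbit of \<open>h\<close> is finite, some power \<open>a\<^sup>m\<close>, \<open>m > 0\<close>, of each generator \<open>a\<close> fixes \<open>h\<close>, and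
  then \<open>h (a\<^sup>n) + h (a\<^sup>-\<^sup>n) = 0\<close> for all multiples \<open>n\<close> of \<open>m\<close>. For two generators and large \<open>n\<close>,
  approximate \<open>h\<close> at the four points \<open>a\<^sup>n, a\<^sup>-\<^sup>n, b\<^sup>n, b\<^sup>-\<^sup>n\<close> by the functional of a point \<open>p\<close>. The
  first letter of \<open>p\<close> belongs to at most one of the two generators, so for the other one, say
  \<open>a\<close>, the inequality makes both \<open>h (a\<^sup>n)\<close> and \<open>h (a\<^sup>-\<^sup>n)\<close> positive, a contradiction.
\<close>

section \<open>Word metrics\<close>

text \<open>Right multiplication by a product is a chain of right multiplications, so induction over
  \<open>generate\<close>, for all starting points \<open>z\<close> at once, composes paths;
  symmetry of \<open>S\<close> serves the inverses. The element to generate is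
  \<open>inv x \<otimes> y\<close>.\<close>

lemma (in group) cayley_edges_connected:
  assumes "S \<subseteq> carrier G" "m_inv G ` S = S" "generate G S = carrier G"
    and x: "x \<in> carrier G" and y: "y \<in> carrier G"
  shows "(x, y) \<in> (cayley_edges G S)\<^sup>*"
proof -
  have edge: "(z, z \<otimes> s) \<in> cayley_edges G S" if "z \<in> carrier G" "s \<in> S" for z s
  proof -
    have "s \<in> carrier G" using that assms(1) by blast
    then show ?thesis
      using that by (simp add: cayley_edges_def m_assoc[symmetric])
  qed
  have "g \<in> carrier G \<and> (\<forall>z\<in>carrier G. (z, z \<otimes> g) \<in> (cayley_edges G S)\<^sup>*)"
    if "g \<in> generate G S" for g
    using that
  proof induction
    case one
    then show ?case by simp
  next
    case (incl s)
    then show ?case using edge assms(1) by blast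
  next
    case (inv s)
    then have "inv s \<in> S" using assms(2) by blast
    then show ?case using edge assms(1) by blast
  next
    case (eng g g')
    then show ?case by (metis m_assoc m_closed rtrancl_trans)
  qed
  moreover have "inv x \<otimes> y \<in> generate G S" using assms by simp
  ultimately have "(x, x \<otimes> (inv x \<otimes> y)) \<in> (cayley_edges G S)\<^sup>*" using x by blast
  then show ?thesis using x y by (simp add: m_assoc[symmetric])
qed

lemma cayley_metric_le:
  assumes "(x, y) \<in> cayley_edges G S ^^ n"
  shows "cayley_metric G S x y \<le> real n"
  using assms by (simp add: cayley_metric_def Least_le)

lemma cayley_metric_attained:
  assumes "(x, y) \<in> (cayley_edges G S)\<^sup>*"
  obtains n where "(x, y) \<in> cayley_edges G S ^^ n" "cayley_metric G S x y = real n"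
proof -
  obtain n where "(x, y) \<in> cayley_edges G S ^^ n"
    using assms unfolding rtrancl_power by blast
  then have "(x, y) \<in> cayley_edges G S ^^ (LEAST n. (x, y) \<in> cayley_edges G S ^^ n)"
    by (rule LeastI)
  then show thesis by (rule that) (simp add: cayley_metric_def)
qed

lemma cayley_metric_triangle:
  assumes "(x, y) \<in> (cayley_edges G S)\<^sup>*" "(y, z) \<in> (cayley_edges G S)\<^sup>*"
  shows "cayley_metric G S x z \<le> cayley_metric G S x y + cayley_metric G S y z"
proof -
  obtain m where m: "(x, y) \<in> cayley_edges G S ^^ m" "cayley_metric G S x y = real m"
    using assms(1) by (rule cayley_metric_attained)
  obtain n where n: "(y, z) \<in> cayley_edges G S ^^ n" "cayley_metric G S y z = real n"
    using assms(2) by (rule cayley_metric_attained)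
  have "(x, z) \<in> cayley_edges G S ^^ (m + n)"
    unfolding relpow_add using m(1) n(1) by (rule relcompI)
  then have "cayley_metric G S x z \<le> real (m + n)" by (rule cayley_metric_le)
  then show ?thesis unfolding m(2) n(2) by simp
qed


section \<open>Words in the free group\<close>

lemma mult_free_group [simp]: "u \<otimes>\<^bsub>free_group X\<^esub> v = foldr cons_reduce u v"
  and one_free_group [simp]: "\<one>\<^bsub>free_group X\<^esub> = []"
  and in_carrier_free_group [simp]:
    "w \<in> carrier (free_group X) \<longleftrightarrow> reduced w \<and> set w \<subseteq> X \<times> UNIV"
  by (simp_all add: free_group_def)

lemma length_foldr_cons_reduce: "length (foldr cons_reduce u v) \<le> length u + length v"
proof (induction u)
  case (Cons a u)
  have "length (cons_reduce a w) \<le> Suc (length w)" for w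
    by (cases w) auto
  from this[of "foldr cons_reduce u v"] Cons show ?case by simp
qed simp

text \<open>The product recurses on its left factor, so the effect of one letter at the right end
  takes an induction of its own.\<close>

lemma foldr_cons_reduce_letter:
  assumes "reduced u"
  shows "foldr cons_reduce u [x] =
    (if u \<noteq> [] \<and> last u = inv_letter x then butlast u else u @ [x])"
  using assms
proof (induction u)
  case (Cons a u)
  show ?case
  proof (cases "u = []")
    case True
    then show ?thesis by (cases a; cases x) auto
  next
    case False
    then have r: "reduced u" "hd u \<noteq> inv_letter a" using Cons.prems by (auto simp: reduced_Cons)
    then show ?thesis using Cons.IH[OF r(1)] False
      by (cases u; cases "tl u") auto
  qed
qed simp

text \<open>Each letter of \<open>v\<close> acts at the right end of the word built so far and
  deletes at most one letter there; fewer than \<open>length u\<close> letters never reach the first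
  one.\<close>

lemma take_1_foldr_cons_reduce:
  assumes "reduced u" "reduced v" "length v < length u"
  shows "take 1 (foldr cons_reduce u v) = take 1 u"
  using assms
proof (induction v arbitrary: u)
  case Nil
  then show ?case by (simp add: foldr_Nil)
next
  case (Cons x v)
  let ?u = "foldr cons_reduce u [x]"
  have v: "reduced v" and xv: "cons_reduce x v = x # v"
    using Cons.prems(2) by (cases v; auto simp: reduced_Cons)+
  have "length v < length ?u \<and> take 1 ?u = take 1 u"
    using Cons.prems(3) foldr_cons_reduce_letter[OF Cons.prems(1), of x]
    by (cases u) (auto simp: take_Cons')
  moreover have "reduced ?u"
    by (simp add: reduced_foldr reduced_Cons)
  moreover have "foldr cons_reduce u (x # v) = foldr cons_reduce ?u v"
    using foldr_assoc[OF v, of u "[x]"] xv by simp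
  ultimately show ?case using Cons.IH[of ?u] v by simp
qed

lemma reduced_replicate: "reduced (replicate n l)"
  by (induction n) (auto simp: reduced_Cons gr0_conv_Suc)

lemma free_group_pow_letter: "[l] [^]\<^bsub>free_group X\<^esub> n = replicate n l"
proof (induction n)
  case (Suc n)
  have "\<not> (replicate n l \<noteq> [] \<and> last (replicate n l) = inv_letter l)" by (cases n) auto
  then have "foldr cons_reduce (replicate n l) [l] = replicate n l @ [l]"
    by (simp only: foldr_cons_reduce_letter[OF reduced_replicate] if_False)
  then show ?case using Suc by (simp add: nat_pow_def replicate_append_same del: foldr_replicate)
qed (simp add: nat_pow_def)

lemma inv_free_group_letter:
  assumes "fst l \<in> X"
  shows "inv\<^bsub>free_group X\<^esub> [l] = [inv_letter l]"
proof -
  interpret group "free_group X" by (rule group_free_group)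
  show ?thesis
    using assms by (intro inv_equality) (cases l; auto simp: reduced_Cons)+
qed


section \<open>Paths that change the first letter\<close>

lemma cayley_edge_free_groupE:
  assumes "(u, v) \<in> cayley_edges (free_group X) S"
  obtains s where "s \<in> S" "reduced s" "reduced u" "v = foldr cons_reduce u s"
proof -
  interpret group "free_group X" by (rule group_free_group)
  have uv: "u \<in> carrier (free_group X)" "v \<in> carrier (free_group X)"
    "inv\<^bsub>free_group X\<^esub> u \<otimes>\<^bsub>free_group X\<^esub> v \<in> S"
    using assms by (auto simp: cayley_edges_def)
  let ?s = "inv\<^bsub>free_group X\<^esub> u \<otimes>\<^bsub>free_group X\<^esub> v"
  have "?s \<in> carrier (free_group X)" using uv by blast
  moreover have "u \<otimes>\<^bsub>free_group X\<^esub> ?s = v"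
    using uv(1,2) by (metis inv_solve_left inv_closed m_closed)
  ultimately show thesis using that[of ?s] uv by simp
qed

lemma length_cayley_path:
  assumes "\<And>s. s \<in> S \<Longrightarrow> length s \<le> K" "(u, v) \<in> cayley_edges (free_group X) S ^^ n"
  shows "length v \<le> length u + n * K"
  using assms(2)
proof (induction n arbitrary: v)
  case (Suc n)
  then obtain w where w: "(u, w) \<in> cayley_edges (free_group X) S ^^ n"
    "(w, v) \<in> cayley_edges (free_group X) S"
    by auto
  obtain s where "s \<in> S" "v = foldr cons_reduce w s"
    using w(2) by (rule cayley_edge_free_groupE)
  then have "length v \<le> length w + K"
    using assms(1) length_foldr_cons_reduce[of w s] by fastforce
  then show ?case using Suc.IH[OF w(1)] by simp
qed simp

text \<open>A step cannot change the first letter of a word longer than \<open>K\<close>. So the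
  path is split just before its first letter first agrees with that of \<open>v\<close>. The empty
  word, where \<open>take 1\<close> gives \<open>[]\<close>, is covered as well.\<close>

lemma cayley_path_crossing:
  assumes S: "\<And>s. s \<in> S \<Longrightarrow> length s \<le> K"
    and "(u, v) \<in> cayley_edges (free_group X) S ^^ n" "take 1 u \<noteq> take 1 v"
  shows "\<exists>i j w. n = i + j \<and> (u, w) \<in> cayley_edges (free_group X) S ^^ i \<and>
    (w, v) \<in> cayley_edges (free_group X) S ^^ j \<and> w \<in> carrier (free_group X) \<and> length w \<le> K"
  using assms(2,3)
proof (induction n arbitrary: u)
  case (Suc n)
  obtain w where w: "(u, w) \<in> cayley_edges (free_group X) S"
    "(w, v) \<in> cayley_edges (free_group X) S ^^ n"
    using relpow_Suc_D2[OF Suc.prems(1)] by blast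
  show ?case
  proof (cases "take 1 w = take 1 v")
    case True
    obtain s where "s \<in> S" "reduced s" "reduced u" "w = foldr cons_reduce u s"
      using w(1) by (rule cayley_edge_free_groupE)
    then have "length u \<le> K"
      using take_1_foldr_cons_reduce[of u s] S[of s] True Suc.prems(2) by fastforce
    moreover have "u \<in> carrier (free_group X)" using w(1) unfolding cayley_edges_def by blast
    ultimately show ?thesis using Suc.prems(1)
      by (intro exI[of _ 0] exI[of _ "Suc n"] exI[of _ u]) simp
  next
    case False
    then obtain i j z where "n = i + j" "(w, z) \<in> cayley_edges (free_group X) S ^^ i"
      "(z, v) \<in> cayley_edges (free_group X) S ^^ j" "z \<in> carrier (free_group X)" "length z \<le> K"
      using Suc.IH[OF w(2)] by blast
    then show ?thesis using w(1) relpow_Suc_I2[OF w(1)]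
      by (intro exI[of _ "Suc i"] exI[of _ j] exI[of _ z]) simp
  qed
qed simp

text \<open>A geodesic from \<open>u\<close> to \<open>v\<close> is cut at a vertex \<open>w\<close>
  of length at most \<open>K\<close>. There are finitely many such words, so replacing
  \<open>w\<close> by the identity costs a bounded amount.\<close>

lemma cayley_metric_free_group_ge:
  fixes X :: "'a set" and S :: "'a letter list set"
  defines "d \<equiv> cayley_metric (free_group X) S"
  assumes "finite X" and K: "\<And>s. s \<in> S \<Longrightarrow> length s \<le> K"
    and conn: "\<And>u v. u \<in> carrier (free_group X) \<Longrightarrow> v \<in> carrier (free_group X) \<Longrightarrow>
      (u, v) \<in> (cayley_edges (free_group X) S)\<^sup>*"
  obtains C where "\<And>u v. u \<in> carrier (free_group X) \<Longrightarrow> v \<in> carrier (free_group X) \<Longrightarrow>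
    take 1 u \<noteq> take 1 v \<Longrightarrow> d u v \<ge> d u [] + d [] v - C"
proof -
  let ?B = "{w \<in> carrier (free_group X). length w \<le> K}"
  have "?B \<subseteq> {w. set w \<subseteq> X \<times> UNIV \<and> length w \<le> K}" by auto
  moreover have "finite {w. set w \<subseteq> X \<times> (UNIV :: bool set) \<and> length w \<le> K}"
    using \<open>finite X\<close> by (intro finite_lists_length_le) auto
  ultimately have "finite ?B" by (rule finite_subset)
  \<comment> \<open>The two summands are the errors made when \<open>d u []\<close> and
    \<open>d [] v\<close> are estimated through \<open>w\<close>.\<close>
  define C where "C = Max ((\<lambda>w. d w [] + d [] w) ` ?B)"
  have C: "d w [] + d [] w \<le> C" if "w \<in> ?B" for w
    unfolding C_def using \<open>finite ?B\<close> that by (intro Max_ge) auto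
  have "d u v \<ge> d u [] + d [] v - C"
    if uv: "u \<in> carrier (free_group X)" "v \<in> carrier (free_group X)" "take 1 u \<noteq> take 1 v" for u v
  proof -
    obtain n where n: "(u, v) \<in> cayley_edges (free_group X) S ^^ n" "d u v = real n"
      unfolding d_def using conn[OF uv(1,2)] by (rule cayley_metric_attained)
    obtain i j w where w: "n = i + j" "(u, w) \<in> cayley_edges (free_group X) S ^^ i"
      "(w, v) \<in> cayley_edges (free_group X) S ^^ j" "w \<in> ?B"
      using cayley_path_crossing[OF K n(1) uv(3)] by blast
    have "d u w + d w v \<le> d u v"
      using cayley_metric_le[OF w(2)] cayley_metric_le[OF w(3)] n(2) w(1) by (simp add: d_def)
    moreover have "d u [] \<le> d u w + d w []" "d [] v \<le> d [] w + d w v"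
      unfolding d_def using uv w(4) by (intro cayley_metric_triangle conn; simp)+
    ultimately show ?thesis using C[OF w(4)] by linarith
  qed
  then show thesis by (rule that)
qed


section \<open>The boundary action\<close>

text \<open>By pigeonhole two powers of \<open>x\<close> send \<open>h\<close> to the same function,
  so a positive power of \<open>x\<close> fixes \<open>h\<close>. Then \<open>h\<close> is additive
  along the powers of that element, and values at opposite powers cancel.\<close>

lemma (in group) finite_orbit_power:
  assumes x: "x \<in> carrier G" and h: "h \<one> = (0 :: real)"
    and fin: "finite (orbit G (boundary_action G) h)"
  obtains m :: nat where "m > 0" "\<And>n :: nat. h (x [^] (m * n)) + h (inv x [^] (m * n)) = 0"
proof -
  let ?f = "\<lambda>n :: nat. boundary_action G (x [^] n) h"
  have "range ?f \<subseteq> orbit G (boundary_action G) h" using x by (auto simp: orbit_def)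
  then have "\<not> inj ?f" using fin finite_subset range_inj_infinite by blast
  then obtain i j where ij: "i < j" "?f i = ?f j"
    unfolding inj_def by (metis linorder_neqE_nat)
  define m where "m = j - i"
  have shift: "h (inv x [^] m \<otimes> y) = h y + h (inv x [^] m)" if y: "y \<in> carrier G" for y
  proof -
    \<comment> \<open>This is \<open>?f i = ?f j\<close> evaluated at
      \<open>x [^] i \<otimes> z\<close>; the case \<open>z = \<one>\<close> then identifies the
      constants.\<close>
    have eq: "h z - h (inv x [^] i) = h (inv x [^] m \<otimes> z) - h (inv x [^] j)"
      if z: "z \<in> carrier G" for z
    proof -
      have "inv x [^] j = inv x [^] m \<otimes> inv x [^] i"
        using x ij(1) by (simp add: nat_pow_mult m_def)
      then have "inv x [^] j \<otimes> (x [^] i \<otimes> z) = inv x [^] m \<otimes> z"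
        using x z by (simp add: nat_pow_inv m_assoc) (simp add: m_assoc[symmetric])
      moreover have "inv x [^] i \<otimes> (x [^] i \<otimes> z) = z"
        using x z by (simp add: nat_pow_inv m_assoc[symmetric])
      ultimately show ?thesis
        using fun_cong[OF ij(2), of "x [^] i \<otimes> z"] x z
        by (simp add: boundary_action_def nat_pow_inv)
    qed
    show ?thesis using eq[OF y] eq[OF one_closed] x h by simp
  qed
  have neg: "h (inv x [^] (m * n)) = n * h (inv x [^] m)" for n
  proof (induction n)
    case (Suc n)
    have "inv x [^] (m * Suc n) = inv x [^] m \<otimes> inv x [^] (m * n)"
      using x by (simp add: nat_pow_mult)
    then show ?case using shift[of "inv x [^] (m * n)"] Suc x by (simp add: algebra_simps)
  qed (use h in simp)
  have pos: "h (x [^] (m * n)) = - n * h (inv x [^] m)" for n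
  proof (induction n)
    case (Suc n)
    have "x [^] (m * Suc n) = x [^] m \<otimes> x [^] (m * n)"
      using x by (simp add: nat_pow_mult)
    then have "inv x [^] m \<otimes> x [^] (m * Suc n) = x [^] (m * n)"
      using x by (simp add: nat_pow_inv m_assoc[symmetric])
    then show ?case using shift[of "x [^] (m * Suc n)"] Suc x by (simp add: algebra_simps)
  qed (use h in simp)
  show thesis
    by (rule that[of m]) (use ij(1) neg pos in \<open>simp_all add: m_def\<close>)
qed

text \<open>Finitely many coordinate conditions cut out a neighbourhood of \<open>h\<close> for
  pointwise convergence, and each neighbourhood of a point of the closure contains a point
  functional.\<close>

lemma metric_compactification_approx:
  assumes h: "h \<in> metric_compactification G d" and "finite Q" "Q \<subseteq> carrier G" "e > 0"
  obtains p where "p \<in> carrier G" "\<And>q. q \<in> Q \<Longrightarrow> \<bar>h q - (d p q - d p \<one>\<^bsub>G\<^esub>)\<bar> < e"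
proof -
  let ?T = "lip_topology G d"
  define U where "U q = {f \<in> topspace ?T. f q \<in> {h q - e<..<h q + e}}" for q
  define W where "W = topspace ?T \<inter> (\<Inter>q\<in>Q. U q)"
  have closure: "h \<in> topspace ?T"
    "\<And>V. h \<in> V \<Longrightarrow> openin ?T V \<Longrightarrow> \<exists>f. f \<in> point_functional G d ` carrier G \<and> f \<in> V"
    using h unfolding metric_compactification_def in_closure_of by simp_all
  have "openin ?T (U q)" if "q \<in> Q" for q
    unfolding U_def
  proof (rule openin_continuous_map_preimage)
    show "continuous_map ?T euclideanreal (\<lambda>f. f q)"
      unfolding lip_topology_def using that assms(3)
      by (intro continuous_map_from_subtopology continuous_map_product_projection) auto
  qed simp
  then have "openin ?T W"
    unfolding W_def using \<open>finite Q\<close> by (cases "Q = {}") auto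
  moreover have "h \<in> W" unfolding W_def U_def using closure(1) \<open>e > 0\<close> by simp
  ultimately obtain p where p: "p \<in> carrier G" "point_functional G d p \<in> W"
    by (blast dest: closure(2))
  have "\<bar>h q - (d p q - d p \<one>\<^bsub>G\<^esub>)\<bar> < e" if q: "q \<in> Q" for q
  proof -
    have "point_functional G d p q = d p q - d p \<one>\<^bsub>G\<^esub>"
      using q assms(3) by (simp add: point_functional_def subset_iff)
    moreover have "point_functional G d p q \<in> {h q - e<..<h q + e}"
      using p(2) q unfolding W_def U_def by simp
    ultimately show ?thesis by (simp add: abs_less_iff)
  qed
  then show thesis by (rule that[OF p(1)])
qed

lemma metric_compactification_one:
  assumes "h \<in> metric_compactification G d"
  shows "h \<one>\<^bsub>G\<^esub> = 0"
  using assms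
  by (auto simp: metric_compactification_def in_closure_of lip_topology_def lip_functions_def)

theorem corollary2p3:
  fixes k :: nat and S :: "nat letter list set"
  assumes "k \<ge> 2"
    and "S \<subseteq> carrier (free_group {..<k})"
    and "finite S"
    and "m_inv (free_group {..<k}) ` S = S"
    and "generate (free_group {..<k}) S = carrier (free_group {..<k})"
  shows "\<forall>h \<in> metric_boundary (free_group {..<k}) (cayley_metric (free_group {..<k}) S).
           infinite (orbit (free_group {..<k}) (boundary_action (free_group {..<k})) h)"
proof
  let ?F = "free_group {..<k}"
  let ?d = "cayley_metric ?F S"
  interpret group ?F by (rule group_free_group)
  fix h assume "h \<in> metric_boundary ?F ?d"
  then have h: "h \<in> metric_compactification ?F ?d" by (simp add: metric_boundary_def)
  show "infinite (orbit ?F (boundary_action ?F) h)"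
  proof
    assume fin: "finite (orbit ?F (boundary_action ?F) h)"
    obtain K where K: "length s \<le> K" if "s \<in> S" for s
      using \<open>finite S\<close> by (meson finite_nat_set_iff_bounded_le finite_imageI imageI)
    note conn = cayley_edges_connected[OF assms(2,4,5)]
    obtain C where C: "?d u v \<ge> ?d u [] + ?d [] v - C"
      if "u \<in> carrier ?F" "v \<in> carrier ?F" "take 1 u \<noteq> take 1 v" for u v
      using cayley_metric_free_group_ge[OF finite_lessThan K conn] by metis
    \<comment> \<open>A step lengthens a word by at most \<open>K\<close>, so a word of length at
      least \<open>N\<close> is more than \<open>nat \<lceil>C + 1\<rceil>\<close> steps from the
      identity. Here \<open>C\<close> pays for the detour and \<open>1\<close> for the approximation
      error.\<close>
    define N where "N = Suc (K * nat \<lceil>C + 1\<rceil>)"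
    have far: "?d [] v > C + 1" if v: "v \<in> carrier ?F" "length v \<ge> N" for v
    proof -
      obtain n where n: "([], v) \<in> cayley_edges ?F S ^^ n" "?d [] v = real n"
        using cayley_metric_attained[OF conn[of "[]" v]] v(1) by auto
      have "length v \<le> length ([] :: nat letter list) + n * K"
        using K n(1) by (rule length_cayley_path)
      then have "K * nat \<lceil>C + 1\<rceil> < n * K" using v(2) unfolding N_def list.size by linarith
      then have "nat \<lceil>C + 1\<rceil> < n" by (metis mult.commute mult_less_cancel1)
      then show ?thesis unfolding n(2) by linarith
    qed
    have "\<exists>n\<ge>N. h (replicate n (a, True)) + h (replicate n (a, False)) = 0" if "a < k" for a
    proof -
      have "[(a, True)] \<in> carrier ?F" using that by (simp add: reduced_Cons)
      then obtain m where m: "m > 0"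
        "\<And>n :: nat. h ([(a, True)] [^]\<^bsub>?F\<^esub> (m * n)) + h (inv\<^bsub>?F\<^esub> [(a, True)] [^]\<^bsub>?F\<^esub> (m * n)) = 0"
        using finite_orbit_power metric_compactification_one[OF h] fin by metis
      show ?thesis
      proof (intro exI conjI)
        \<comment> \<open>The exponent has to be a multiple of the period \<open>m\<close> and at
          least \<open>N\<close>.\<close>
        show "m * N \<ge> N" using m(1) by simp
        show "h (replicate (m * N) (a, True)) + h (replicate (m * N) (a, False)) = 0"
          using m(2)[of N] that by (simp add: free_group_pow_letter inv_free_group_letter)
      qed
    qed
    then obtain n where n: "n a \<ge> N" "h (replicate (n a) (a, True)) + h (replicate (n a) (a, False)) = 0"
      if "a < k" for a
      by metis
    \<comment> \<open>The four test points; the generators \<open>0\<close> and \<open>1\<close>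
      exist because \<open>k \<ge> 2\<close>.\<close>
    define Q where "Q = (\<lambda>(a, e). replicate (n a) (a, e)) ` ({0, 1} \<times> (UNIV :: bool set))"
    have Q: "replicate (n a) (a, e) \<in> Q" if "a \<in> {0, 1}" for a and e :: bool
      unfolding Q_def using that by (intro image_eqI[of _ _ "(a, e)"]) auto
    have "Q \<subseteq> carrier ?F" using assms(1) by (auto simp: Q_def reduced_replicate)
    moreover have "finite Q" by (simp add: Q_def)
    ultimately obtain p where p: "p \<in> carrier ?F"
      "\<And>q. q \<in> Q \<Longrightarrow> \<bar>h q - (?d p q - ?d p [])\<bar> < 1"
      using metric_compactification_approx[OF h, of Q 1] by auto
    \<comment> \<open>Generator \<open>1\<close> serves if \<open>p\<close> begins with a letter of
      \<open>0\<close>, and generator \<open>0\<close> in all other cases, among them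
      \<open>p = []\<close>.\<close>
    obtain a :: nat where a: "a \<in> {0, 1}" "\<And>e. take 1 p \<noteq> [(a, e)]"
    proof (cases "\<exists>e. take 1 p = [(0, e)]")
      case True
      then show ?thesis using that[of 1] by auto
    next
      case False
      then show ?thesis using that[of 0] by auto
    qed
    then have "a < k" using assms(1) by auto
    \<comment> \<open>The functional of \<open>p\<close> is at least \<open>?d [] ?q - C > 1\<close>
      at \<open>?q\<close>, and \<open>h\<close> differs from it there by less than
      \<open>1\<close>.\<close>
    have "h (replicate (n a) (a, e)) > 0" for e
    proof -
      let ?q = "replicate (n a) (a, e)"
      have q: "?q \<in> carrier ?F" using \<open>a < k\<close> by (auto simp: reduced_replicate)
      have "n a > 0" using n(1)[OF \<open>a < k\<close>] by (simp add: N_def)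
      then have "take 1 ?q = [(a, e)]" by (cases "n a") auto
      then have "?d p ?q \<ge> ?d p [] + ?d [] ?q - C" using C[OF p(1) q] a(2) by simp
      moreover have "?d [] ?q > C + 1" using far[OF q] n(1)[OF \<open>a < k\<close>] by simp
      ultimately show ?thesis using p(2)[OF Q[OF a(1), of e]] by linarith
    qed
    from this[of True] this[of False] show False using n(2)[OF \<open>a < k\<close>] by linarith
  qed
qed

end
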